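(* Let $\mathcal Z$ be a discrete number system. The object function $x\mapsto +x$ of the isomorphism $\oplus$ defines a full operation $+$ assigning to each object $x$ of $\mathcal Z$ a bijection $+x$ of the collection of objects of $\mathcal Z$ onto itself (written $a\mapsto a+x$). Furthermore: 1) The automorphisms $+x$ ($x$ an object of $\mathcal Z$) form a commutative group $\mathbb Z^\dagger$ under composition. 2) Using the operation $+$, one obtains a commutative group $\mathbb Z$ on the objects of the discrete number system. 3) There is an isomorphism $\mathbb Z\to\mathbb Z^\dagger$.
   Context: A discrete number system $\mathcal Z$ is a nonempty collection of objects with arrows such that every object is the source of exactly one arrow and the target of exactly one arrow, the objects and arrows being arranged in a single two-way infinite chain $\cdots\to -2\to -1\to 0\to 1\to 2\to\cdots$ (one object is chosen and called $0$), and the arrows are components of a strict total order. $\mathcal Z_\le$ is the partial order obtained by adding the transitive and reflexive arrows. For an object $x$, $x+1$ denotes the target of the unique arrow with source $x$, and $x-1$ the source of the unique arrow with target $x$. Automorphisms $+x:\mathcal Z_\le\to\mathcal Z_\le$ are defined as follows: $+0$ is the identity; $+1$ sends each object to the target of its arrow in $\mathcal Z$; $+(-1)$ is the inverse of $+1$; $+(x+1):=(+1)\circ(+x)$ for $0<x+1$; and $+(x-1):=(+(-1))\circ(+x)$ for $x-1<0$. The functor $\oplus$ sends $x$ to $+x$. The collection $\{+x\}$ is ordered by $+x\le +y$ iff $a+x\le a+y$ for all objects $a$, and $\oplus$ is an isomorphism of partial orders from $\mathcal Z_\le$ onto it. An operation is full if each function it assigns has the whole collection as domain. In 2) the product of objects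 $a$ and $x$ is $a+x$, i.e. the image of $a$ under $+x$. *)

theory Defs
  imports "HOL-Algebra.Group"
begin

text \<open>
  Every object is the source of exactly one arrow, so no two arrows are parallel and the
  arrows can be taken to form a relation: \<open>(x, y) \<in> arrows Z\<close> means that there is an arrow
  from \<open>x\<close> to \<open>y\<close>. The field \<open>origin\<close> is the object called \<open>0\<close>.
\<close>

record 'a number_system = "'a partial_object" +
  arrows :: "'a rel"
  origin :: 'a

text \<open>
  The condition \<open>single_chain\<close> says that of any two objects one is reached from the other
  by following finitely many arrows. That the chain is infinite in both directions, and not
  a cycle, follows from \<open>ordered\<close>. The carrier is nonempty by \<open>origin_closed\<close>.
\<close>

locale discrete_number_system =
  fixes Z :: "('a, 'b) number_system_scheme" (structure)
  assumes arrows_closed: "arrows Z \<subseteq> carrier Z \<times> carrier Z"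
    and origin_closed: "origin Z \<in> carrier Z"
    and unique_target: "x \<in> carrier Z \<Longrightarrow> \<exists>!y. (x, y) \<in> arrows Z"
    and unique_source: "y \<in> carrier Z \<Longrightarrow> \<exists>!x. (x, y) \<in> arrows Z"
    and single_chain: "\<lbrakk>x \<in> carrier Z; y \<in> carrier Z\<rbrakk> \<Longrightarrow>
      (x, y) \<in> (arrows Z)\<^sup>* \<or> (y, x) \<in> (arrows Z)\<^sup>*"
    and ordered: "\<exists>r. r \<subseteq> carrier Z \<times> carrier Z \<and>
      strict_linear_order_on (carrier Z) r \<and> arrows Z \<subseteq> r"

definition le_rel :: "('a, 'b) number_system_scheme \<Rightarrow> 'a rel" where
  "le_rel Z = (arrows Z)\<^sup>+ \<union> Id_on (carrier Z)"

definition less_rel :: "('a, 'b) number_system_scheme \<Rightarrow> 'a rel" where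
  "less_rel Z = le_rel Z - Id"

definition succ_obj :: "('a, 'b) number_system_scheme \<Rightarrow> 'a \<Rightarrow> 'a" where
  "succ_obj Z x = (THE y. (x, y) \<in> arrows Z)"

definition pred_obj :: "('a, 'b) number_system_scheme \<Rightarrow> 'a \<Rightarrow> 'a" where
  "pred_obj Z y = (THE x. (x, y) \<in> arrows Z)"

text \<open>
  Functions with domain \<open>carrier Z\<close> are represented extensionally, that is, with the value
  \<open>undefined\<close> outside the carrier, so that their equality and composition are those of
  functions on the carrier.
\<close>

definition plus_one :: "('a, 'b) number_system_scheme \<Rightarrow> 'a \<Rightarrow> 'a" where
  "plus_one Z = (\<lambda>a\<in>carrier Z. succ_obj Z a)"

definition plus_minus_one :: "('a, 'b) number_system_scheme \<Rightarrow> 'a \<Rightarrow> 'a" where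
  "plus_minus_one Z = (\<lambda>a\<in>carrier Z. inv_into (carrier Z) (plus_one Z) a)"

text \<open>
  \<open>plus_graph Z x f\<close> is the graph of the assignment of \<open>f = +x\<close> to \<open>x\<close>, given by the
  recursion outwards from \<open>0\<close> in both directions.
\<close>

inductive plus_graph :: "('a, 'b) number_system_scheme \<Rightarrow> 'a \<Rightarrow> ('a \<Rightarrow> 'a) \<Rightarrow> bool"
  for Z where
  zero: "plus_graph Z (origin Z) (\<lambda>a\<in>carrier Z. a)"
| one: "plus_graph Z (succ_obj Z (origin Z)) (plus_one Z)"
| minus_one: "plus_graph Z (pred_obj Z (origin Z)) (plus_minus_one Z)"
| up: "\<lbrakk>x \<in> carrier Z; (origin Z, succ_obj Z x) \<in> less_rel Z; plus_graph Z x f\<rbrakk> \<Longrightarrow>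
    plus_graph Z (succ_obj Z x) (compose (carrier Z) (plus_one Z) f)"
| down: "\<lbrakk>x \<in> carrier Z; (pred_obj Z x, origin Z) \<in> less_rel Z; plus_graph Z x f\<rbrakk> \<Longrightarrow>
    plus_graph Z (pred_obj Z x) (compose (carrier Z) (plus_minus_one Z) f)"

text \<open>\<open>plus_map Z x\<close> is the function \<open>+x\<close>; so \<open>plus_map Z x a\<close> is \<open>a + x\<close>, in this order.\<close>

definition plus_map :: "('a, 'b) number_system_scheme \<Rightarrow> 'a \<Rightarrow> 'a \<Rightarrow> 'a" where
  "plus_map Z x = (THE f. plus_graph Z x f)"

definition full_operation :: "'a set \<Rightarrow> ('a \<Rightarrow> 'a \<Rightarrow> 'a) \<Rightarrow> bool" where
  "full_operation S h \<longleftrightarrow> (\<forall>x\<in>S. h x \<in> S \<rightarrow>\<^sub>E S)"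

definition order_isomorphism ::
    "'a set \<Rightarrow> 'a rel \<Rightarrow> 'b set \<Rightarrow> 'b rel \<Rightarrow> ('a \<Rightarrow> 'b) \<Rightarrow> bool" where
  "order_isomorphism A r B s f \<longleftrightarrow>
    partial_order_on A r \<and> partial_order_on B s \<and> bij_betw f A B \<and>
    (\<forall>x\<in>A. \<forall>y\<in>A. (x, y) \<in> r \<longleftrightarrow> (f x, f y) \<in> s)"

definition plus_maps :: "('a, 'b) number_system_scheme \<Rightarrow> ('a \<Rightarrow> 'a) set" where
  "plus_maps Z = plus_map Z ` carrier Z"

definition plus_maps_le :: "('a, 'b) number_system_scheme \<Rightarrow> ('a \<Rightarrow> 'a) rel" where
  "plus_maps_le Z = {(f, g). f \<in> plus_maps Z \<and> g \<in> plus_maps Z \<and>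
    (\<forall>a\<in>carrier Z. (f a, g a) \<in> le_rel Z)}"

definition plus_maps_group :: "('a, 'b) number_system_scheme \<Rightarrow> ('a \<Rightarrow> 'a) monoid" where
  "plus_maps_group Z =
    \<lparr>carrier = plus_maps Z, monoid.mult = compose (carrier Z), one = (\<lambda>a\<in>carrier Z. a)\<rparr>"

definition object_group :: "('a, 'b) number_system_scheme \<Rightarrow> 'a monoid" where
  "object_group Z =
    \<lparr>carrier = carrier Z, monoid.mult = (\<lambda>a x. plus_map Z x a), one = origin Z\<rparr>"

end

theory Submission
  imports Defs
begin

text \<open>
  A discrete number system is a copy of the integers. Walking \<open>n\<close> steps along the chain from \<open>0\<close>,
  forwards or backwards, leads to an object \<open>place n\<close>, and \<open>place\<close> is a bijection from the
  integers onto the objects: onto because the chain is single, one-to-one because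
  a strict order that contains the arrows forbids cycles. It turns the arrows into the pairs
  \<open>(n, n + 1)\<close> and hence \<open>\<le>\<close> into the order of the integers.

  In this coordinate the recursion for \<open>+x\<close> has a closed solution: for \<open>x = place n\<close>, the function
  \<open>+x\<close> is the translation \<open>place m \<mapsto> place (m + n)\<close>. The recursion may reach an object by
  several derivations (\<open>+1\<close> is given outright and also comes from \<open>+0\<close> by an upward step), but
  each of them yields this translation, so \<open>+x\<close> is well defined (\<open>plus_map_place\<close>).

  Everything else is transported from the integers. Addition of integers becomes both composition
  of translations and addition of objects, so both structures are commutative groups. Since
  \<open>m + n \<le> m + k\<close> exactly when \<open>n \<le> k\<close>, translations are order automorphisms and are ordered like
  the objects that they come from. A translation is determined by the image of \<open>0\<close>, so
  \<open>x \<mapsto> +x\<close> is one-to-one, and it is the isomorphism between the two groups.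
\<close>

section \<open>Transport of structure from the integers\<close>

lemma partial_order_on_range_int:
  fixes h :: "int \<Rightarrow> 'c"
  assumes "r \<subseteq> range h \<times> range h"
    and le: "\<And>m n. (h m, h n) \<in> r \<longleftrightarrow> m \<le> n"
  shows "partial_order_on (range h) r"
proof -
  have range: "\<exists>m n. x = h m \<and> y = h n" if "(x, y) \<in> r" for x y
    using assms(1) that by blast
  have "refl_on (range h) r"
    by (auto simp: refl_on_def le)
  moreover have "trans r"
  proof (rule transI)
    fix x y z assume xy: "(x, y) \<in> r" and yz: "(y, z) \<in> r"
    then obtain m n k where "x = h m" "y = h n" "z = h k"
      using range by blast
    with xy yz show "(x, z) \<in> r"
      by (simp add: le)
  qed
  moreover have "antisym r"
  proof (rule antisymI)
    fix x y assume xy: "(x, y) \<in> r" and yx: "(y, x) \<in> r"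
    then obtain m n where "x = h m" "y = h n"
      using range by blast
    with xy yx show "x = y"
      by (simp add: le)
  qed
  ultimately show ?thesis
    using assms(1) by (simp add: partial_order_on_def preorder_on_def)
qed

lemma comm_group_range_int:
  fixes h :: "int \<Rightarrow> 'c" and G :: "('c, 'd) monoid_scheme"
  assumes carrier: "carrier G = range h"
    and mult: "\<And>m n. h m \<otimes>\<^bsub>G\<^esub> h n = h (m + n)"
    and one: "\<one>\<^bsub>G\<^esub> = h 0"
  shows "comm_group G"
proof (rule comm_groupI)
  fix x assume "x \<in> carrier G"
  then obtain n where "x = h n"
    using carrier by blast
  then have "h (- n) \<otimes>\<^bsub>G\<^esub> x = \<one>\<^bsub>G\<^esub>"
    by (simp add: mult one)
  then show "\<exists>y\<in>carrier G. y \<otimes>\<^bsub>G\<^esub> x = \<one>\<^bsub>G\<^esub>"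
    using carrier by blast
qed (auto simp: carrier mult one ac_simps)

section \<open>Coordinates on a discrete number system\<close>

context discrete_number_system
begin

lemma succ_obj_arrow: "x \<in> carrier Z \<Longrightarrow> (x, succ_obj Z x) \<in> arrows Z"
  unfolding succ_obj_def by (rule theI') (rule unique_target)

lemma pred_obj_arrow: "y \<in> carrier Z \<Longrightarrow> (pred_obj Z y, y) \<in> arrows Z"
  unfolding pred_obj_def by (rule theI') (rule unique_source)

lemma succ_obj_closed: "x \<in> carrier Z \<Longrightarrow> succ_obj Z x \<in> carrier Z"
  using succ_obj_arrow arrows_closed by blast

lemma pred_obj_closed: "x \<in> carrier Z \<Longrightarrow> pred_obj Z x \<in> carrier Z"
  using pred_obj_arrow arrows_closed by blast

lemma arrow_iff_succ_obj:
  "(x, y) \<in> arrows Z \<longleftrightarrow> x \<in> carrier Z \<and> y = succ_obj Z x"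
  using succ_obj_arrow unique_target arrows_closed by blast

lemma succ_pred_obj: "x \<in> carrier Z \<Longrightarrow> succ_obj Z (pred_obj Z x) = x"
  using pred_obj_arrow arrow_iff_succ_obj by auto

lemma pred_succ_obj: "x \<in> carrier Z \<Longrightarrow> pred_obj Z (succ_obj Z x) = x"
  using succ_obj_arrow pred_obj_arrow succ_obj_closed unique_source by blast

definition place :: "int \<Rightarrow> 'a" where
  "place n = (if 0 \<le> n then (succ_obj Z ^^ nat n) (origin Z)
    else (pred_obj Z ^^ nat (- n)) (origin Z))"

lemma place_0: "place 0 = origin Z"
  by (simp add: place_def)

lemma place_closed: "place n \<in> carrier Z"
proof -
  have "(succ_obj Z ^^ k) (origin Z) \<in> carrier Z" for k
    by (induction k) (simp_all add: origin_closed succ_obj_closed)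
  moreover have "(pred_obj Z ^^ k) (origin Z) \<in> carrier Z" for k
    by (induction k) (simp_all add: origin_closed pred_obj_closed)
  ultimately show ?thesis
    by (simp add: place_def)
qed

lemma succ_obj_place: "succ_obj Z (place n) = place (n + 1)"
proof (cases "0 \<le> n")
  case True
  then have "nat (n + 1) = Suc (nat n)" by simp
  with True show ?thesis by (simp add: place_def)
next
  case False
  then have "nat (- n) = Suc (nat (- (n + 1)))" by simp
  with False have "place n = pred_obj Z (place (n + 1))"
    by (auto simp: place_def)
  then show ?thesis
    by (simp add: succ_pred_obj place_closed)
qed

lemma pred_obj_place: "pred_obj Z (place n) = place (n - 1)"
  using pred_succ_obj[OF place_closed[of "n - 1"]] by (simp add: succ_obj_place)

lemma place_rtrancl_iff:
  "(place m, y) \<in> (arrows Z)\<^sup>* \<longleftrightarrow> (\<exists>n\<ge>m. y = place n)"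
proof
  assume "(place m, y) \<in> (arrows Z)\<^sup>*"
  then show "\<exists>n\<ge>m. y = place n"
  proof induction
    case (step y z)
    then obtain n where "m \<le> n" "z = place (n + 1)"
      using arrow_iff_succ_obj succ_obj_place by auto
    then show ?case
      by (intro exI[of _ "n + 1"]) simp
  qed blast
next
  assume "\<exists>n\<ge>m. y = place n"
  then obtain n where "m \<le> n" and y: "y = place n" by blast
  from \<open>m \<le> n\<close> have "(place m, place n) \<in> (arrows Z)\<^sup>*"
  proof (induction rule: int_ge_induct)
    case (step i)
    have "(place i, place (i + 1)) \<in> arrows Z"
      by (simp add: arrow_iff_succ_obj place_closed succ_obj_place)
    with step.IH show ?case
      by (rule rtrancl_into_rtrancl)
  qed simp
  with y show "(place m, y) \<in> (arrows Z)\<^sup>*" by simp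
qed

lemma place_trancl:
  assumes "m < n"
  shows "(place m, place n) \<in> (arrows Z)\<^sup>+"
proof -
  have "m + 1 \<le> n" using assms by simp
  then have "(place (m + 1), place n) \<in> (arrows Z)\<^sup>*"
    using place_rtrancl_iff by blast
  moreover have "(place m, place (m + 1)) \<in> arrows Z"
    by (simp add: arrow_iff_succ_obj place_closed succ_obj_place)
  ultimately show ?thesis
    by (rule rtrancl_into_trancl2[rotated])
qed

text \<open>
  A coincidence \<open>place m = place n\<close> with \<open>m < n\<close> would make the arrows from \<open>m\<close> to \<open>n\<close> a cycle
  inside a transitive irreflexive relation.
\<close>

lemma inj_place: "inj place"
proof -
  obtain r where r: "strict_linear_order_on (carrier Z) r" "arrows Z \<subseteq> r"
    using ordered by blast
  then have "trans r" "irrefl r"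
    by (simp_all add: strict_linear_order_on_def)
  have "(place m, place n) \<in> r" if "m < n" for m n
    using place_trancl[OF that] trancl_mono[OF _ r(2)] trancl_id[OF \<open>trans r\<close>] by blast
  then have "place m \<noteq> place n" if "m < n" for m n
    using \<open>irrefl r\<close> that by (metis irreflD)
  then show ?thesis
    by (intro injI) (metis linorder_less_linear)
qed

lemma place_eq_iff: "place m = place n \<longleftrightarrow> m = n"
  using inj_place by (simp add: inj_eq)

text \<open>
  An object \<open>x\<close> lies either after \<open>0\<close>, and is then reached forwards, or before \<open>0\<close>. In the second
  case the walk from \<open>x\<close> to \<open>0\<close> is retraced backwards.
\<close>

lemma range_place: "range place = carrier Z"
proof
  show "carrier Z \<subseteq> range place"
  proof
    fix x assume x: "x \<in> carrier Z"
    have "x \<in> range place" if "(x, origin Z) \<in> (arrows Z)\<^sup>*"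
      using that
    proof (induction rule: converse_rtrancl_induct)
      case base
      show ?case by (metis place_0 rangeI)
    next
      case (step y z)
      then obtain n where "z = place n" by blast
      then have "y = place (n - 1)"
        using step.hyps(1) pred_succ_obj by (metis arrow_iff_succ_obj pred_obj_place)
      then show ?case by simp
    qed
    moreover have "x \<in> range place" if "(origin Z, x) \<in> (arrows Z)\<^sup>*"
      using that place_rtrancl_iff[of 0 x] by (auto simp: place_0)
    ultimately show "x \<in> range place"
      using single_chain[OF x origin_closed] by blast
  qed
qed (auto simp: place_closed)

lemma placeE:
  assumes "x \<in> carrier Z"
  obtains n where "x = place n"
  using assms range_place by blast

lemma ball_carrier_place: "(\<forall>x\<in>carrier Z. P x) \<longleftrightarrow> (\<forall>n. P (place n))"
  by (simp flip: range_place)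

lemma le_rel_place_iff: "(place m, place n) \<in> le_rel Z \<longleftrightarrow> m \<le> n"
proof
  assume "(place m, place n) \<in> le_rel Z"
  then have "(place m, place n) \<in> (arrows Z)\<^sup>*"
    by (auto simp: le_rel_def trancl_into_rtrancl)
  then show "m \<le> n"
    by (auto simp: place_rtrancl_iff place_eq_iff)
next
  assume "m \<le> n"
  then show "(place m, place n) \<in> le_rel Z"
    using place_trancl[of m n] by (cases "m = n") (auto simp: le_rel_def place_closed)
qed

lemma less_rel_place_iff: "(place m, place n) \<in> less_rel Z \<longleftrightarrow> m < n"
  by (auto simp: less_rel_def le_rel_place_iff place_eq_iff)

lemma le_rel_closed: "le_rel Z \<subseteq> carrier Z \<times> carrier Z"
  using trancl_subset_Sigma[OF arrows_closed] by (auto simp: le_rel_def)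

lemma partial_order_le_rel: "partial_order_on (carrier Z) (le_rel Z)"
  using partial_order_on_range_int[of "le_rel Z" place] le_rel_closed
  by (simp add: range_place le_rel_place_iff)

section \<open>Addition as translation\<close>

definition translation :: "int \<Rightarrow> 'a \<Rightarrow> 'a" where
  "translation n = (\<lambda>a\<in>carrier Z. place (the_inv place a + n))"

lemma translation_place: "translation n (place m) = place (m + n)"
  by (simp add: translation_def place_closed the_inv_f_f[OF inj_place])

lemma translation_extensional: "translation n \<in> extensional (carrier Z)"
  by (simp add: translation_def)

lemma eq_translationI:
  assumes "f \<in> extensional (carrier Z)" and "\<And>m. f (place m) = place (m + n)"
  shows "f = translation n"
proof (rule extensionalityI[OF assms(1) translation_extensional])
  fix a assume "a \<in> carrier Z"
  then show "f a = translation n a"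
    by (elim placeE) (simp add: assms(2) translation_place)
qed

lemma translation_0: "(\<lambda>a\<in>carrier Z. a) = translation 0"
  by (rule eq_translationI) (simp_all add: place_closed)

lemma compose_translation:
  "compose (carrier Z) (translation m) (translation n) = translation (m + n)"
  by (rule eq_translationI)
    (simp_all add: compose_eq place_closed translation_place ac_simps)

lemma inj_translation: "inj translation"
proof (rule injI)
  fix m n assume "translation m = translation n"
  then have "translation m (place 0) = translation n (place 0)" by simp
  then show "m = n"
    by (simp add: translation_place place_eq_iff)
qed

lemma bij_betw_translation: "bij_betw (translation n) (carrier Z) (carrier Z)"
proof (rule bij_betw_byWitness[where f' = "translation (- n)"])
  show "\<forall>a\<in>carrier Z. translation (- n) (translation n a) = a"
    and "\<forall>a\<in>carrier Z. translation n (translation (- n) a) = a"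
    by (simp_all add: ball_carrier_place translation_place)
  show "translation n ` carrier Z \<subseteq> carrier Z"
    and "translation (- n) ` carrier Z \<subseteq> carrier Z"
    by (simp_all add: translation_def image_subset_iff place_closed)
qed

lemma plus_one_eq_translation: "plus_one Z = translation 1"
  by (rule eq_translationI) (simp_all add: plus_one_def place_closed succ_obj_place)

lemma plus_minus_one_eq_translation: "plus_minus_one Z = translation (- 1)"
proof (rule eq_translationI)
  fix m
  have "inv_into (carrier Z) (plus_one Z) (place m) = place (m - 1)"
  proof (rule inv_into_f_eq)
    show "inj_on (plus_one Z) (carrier Z)"
      using bij_betw_translation[of 1] by (simp add: plus_one_eq_translation bij_betw_def)
  qed (simp_all add: place_closed plus_one_eq_translation translation_place)
  then show "plus_minus_one Z (place m) = place (m + - 1)"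
    by (simp add: plus_minus_one_def place_closed)
qed (simp add: plus_minus_one_def)

text \<open>
  Uniqueness of the value at each object: every derivation keeps in step, since moving the object by
  one place and composing with \<open>+1\<close> or \<open>+(-1)\<close> change the coordinate and the translation
  length by the same amount.
\<close>

lemma plus_graph_imp_translation:
  "plus_graph Z x f \<Longrightarrow> \<exists>n. x = place n \<and> f = translation n"
proof (induction rule: plus_graph.induct)
  case zero
  show ?case
    using place_0 translation_0 by metis
next
  case one
  have "succ_obj Z (origin Z) = place 1"
    using succ_obj_place[of 0] by (simp add: place_0)
  then show ?case
    using plus_one_eq_translation by blast
next
  case minus_one
  have "pred_obj Z (origin Z) = place (- 1)"
    using pred_obj_place[of 0] by (simp add: place_0)
  then show ?case
    using plus_minus_one_eq_translation by blast
next
  case (up x f)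
  then obtain n where "x = place n" "f = translation n" by blast
  then have "succ_obj Z x = place (1 + n)"
    "compose (carrier Z) (plus_one Z) f = translation (1 + n)"
    by (simp_all add: succ_obj_place plus_one_eq_translation compose_translation ac_simps)
  then show ?case by blast
next
  case (down x f)
  then obtain n where "x = place n" "f = translation n" by blast
  then have "pred_obj Z x = place (- 1 + n)"
    "compose (carrier Z) (plus_minus_one Z) f = translation (- 1 + n)"
    by (simp_all add: pred_obj_place plus_minus_one_eq_translation compose_translation)
  then show ?case by blast
qed

text \<open>
  Existence of the value at each object: induction outwards from \<open>0\<close> makes upward steps only to
  positive places and downward steps only to negative ones, which is what the guards of the
  recursion demand.
\<close>

lemma plus_graph_translation: "plus_graph Z (place n) (translation n)"
proof (induction n rule: int_induct[where k = 0])
  case base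
  show ?case
    using plus_graph.zero[of Z] by (simp add: place_0 translation_0)
next
  case (step1 i)
  then have "(origin Z, succ_obj Z (place i)) \<in> less_rel Z"
    using less_rel_place_iff[of 0] by (simp add: place_0 succ_obj_place)
  from plus_graph.up[OF place_closed this step1.IH] show ?case
    by (simp add: succ_obj_place plus_one_eq_translation compose_translation ac_simps)
next
  case (step2 i)
  then have "(pred_obj Z (place i), origin Z) \<in> less_rel Z"
    using less_rel_place_iff[of _ 0] by (simp add: place_0 pred_obj_place)
  from plus_graph.down[OF place_closed this step2.IH] show ?case
    by (simp add: pred_obj_place plus_minus_one_eq_translation compose_translation)
qed

lemma plus_map_place: "plus_map Z (place n) = translation n"
  unfolding plus_map_def
proof (rule the_equality)
  fix f assume "plus_graph Z (place n) f"
  then show "f = translation n"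
    using plus_graph_imp_translation place_eq_iff by metis
qed (rule plus_graph_translation)

lemma plus_maps_eq: "plus_maps Z = range translation"
  by (simp add: plus_maps_def image_image plus_map_place flip: range_place)

lemma bij_betw_plus_map: "bij_betw (plus_map Z) (carrier Z) (plus_maps Z)"
  unfolding bij_betw_def inj_on_def
  by (simp add: ball_carrier_place plus_map_place inj_eq[OF inj_translation] place_eq_iff
      plus_maps_def)

lemma plus_maps_le_translation_iff:
  "(translation m, translation n) \<in> plus_maps_le Z \<longleftrightarrow> m \<le> n"
  by (simp add: plus_maps_le_def plus_maps_eq ball_carrier_place translation_place
      le_rel_place_iff)

lemma partial_order_plus_maps_le: "partial_order_on (plus_maps Z) (plus_maps_le Z)"
  unfolding plus_maps_eq
  by (rule partial_order_on_range_int)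
    (auto simp: plus_maps_le_translation_iff, auto simp: plus_maps_le_def plus_maps_eq)

section \<open>Order automorphisms and groups\<close>

lemma bij_betw_plus_map_apply:
  "x \<in> carrier Z \<Longrightarrow> bij_betw (plus_map Z x) (carrier Z) (carrier Z)"
  by (elim placeE) (simp add: plus_map_place bij_betw_translation)

lemma order_automorphism_plus_map:
  "x \<in> carrier Z \<Longrightarrow>
    order_isomorphism (carrier Z) (le_rel Z) (carrier Z) (le_rel Z) (plus_map Z x)"
  by (elim placeE)
    (simp add: order_isomorphism_def partial_order_le_rel bij_betw_translation plus_map_place
      ball_carrier_place translation_place le_rel_place_iff)

lemma order_isomorphism_plus_map:
  "order_isomorphism (carrier Z) (le_rel Z) (plus_maps Z) (plus_maps_le Z) (plus_map Z)"
  by (simp add: order_isomorphism_def partial_order_le_rel partial_order_plus_maps_le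
      bij_betw_plus_map ball_carrier_place plus_map_place le_rel_place_iff
      plus_maps_le_translation_iff)

lemma full_operation_plus_map: "full_operation (carrier Z) (plus_map Z)"
  unfolding full_operation_def ball_carrier_place plus_map_place
  by (auto simp: PiE_def translation_extensional intro: bij_betw_apply[OF bij_betw_translation])

lemma comm_group_plus_maps_group: "comm_group (plus_maps_group Z)"
  by (rule comm_group_range_int[where h = translation])
    (simp_all add: plus_maps_group_def plus_maps_eq compose_translation translation_0)

lemma comm_group_object_group: "comm_group (object_group Z)"
  by (rule comm_group_range_int[where h = place])
    (simp_all add: object_group_def range_place plus_map_place translation_place place_0)

text \<open>
  The product \<open>a + x\<close> of objects is sent to \<open>+a\<close> after \<open>+x\<close>: both correspond to the sum of the
  coordinates of \<open>a\<close> and \<open>x\<close>.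
\<close>

lemma plus_map_iso: "plus_map Z \<in> iso (object_group Z) (plus_maps_group Z)"
proof (rule isoI)
  show "plus_map Z \<in> hom (object_group Z) (plus_maps_group Z)"
  proof (rule homI)
    fix x y assume "x \<in> carrier (object_group Z)" "y \<in> carrier (object_group Z)"
    then obtain m n where "x = place m" "y = place n"
      using placeE by (metis object_group_def partial_object.select_convs(1))
    then show "plus_map Z (x \<otimes>\<^bsub>object_group Z\<^esub> y)
        = plus_map Z x \<otimes>\<^bsub>plus_maps_group Z\<^esub> plus_map Z y"
      by (simp add: object_group_def plus_maps_group_def plus_map_place translation_place
          compose_translation)
  qed (simp add: object_group_def plus_maps_group_def plus_maps_def)
  show "bij_betw (plus_map Z) (carrier (object_group Z)) (carrier (plus_maps_group Z))"
    by (simp add: object_group_def plus_maps_group_def bij_betw_plus_map)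
qed

end

theorem theorem6p3:
  fixes Z :: "('a, 'b) number_system_scheme"
  assumes "discrete_number_system Z"
  shows "(\<forall>x\<in>carrier Z.
      order_isomorphism (carrier Z) (le_rel Z) (carrier Z) (le_rel Z) (plus_map Z x)) \<and>
    order_isomorphism (carrier Z) (le_rel Z) (plus_maps Z) (plus_maps_le Z) (plus_map Z) \<and>
    full_operation (carrier Z) (plus_map Z) \<and>
    (\<forall>x\<in>carrier Z. bij_betw (plus_map Z x) (carrier Z) (carrier Z)) \<and>
    comm_group (plus_maps_group Z) \<and>
    comm_group (object_group Z) \<and>
    object_group Z \<cong> plus_maps_group Z"
proof -
  interpret discrete_number_system Z by (rule assms)
  show ?thesis
    using order_automorphism_plus_map order_isomorphism_plus_map full_operation_plus_map
      bij_betw_plus_map_apply comm_group_plus_maps_group comm_group_object_group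
      is_isoI[OF plus_map_iso]
    by blast
qed

end
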